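(* Consider a distributed gradient tracking instance given by a consensus matrix $W$ and local curvatures $h_1,\dots,h_N>0$ as described in the context, with essential spectral radius $\sigma\in(0,1)$ of $W$ and curvature dispersion $\eta>0$. Let $\beta\in(0,2)$ and $r\in(R_0(\beta,\sigma),1)$ be given. If $\Phi(r,\beta,\sigma,\eta)<1$, where $$\Phi(r,\beta,\sigma,\eta)=\beta\left(\eta+\frac{\beta\eta^2}{r-|1-\beta|}\right)\frac{\sigma(1+r)}{\left(r-R_T(\beta,\sigma)\right)^2},$$ then $\rho(A(\beta))<r$, where $A(\beta)$ is the reduced system matrix of the instance and $\rho(\cdot)$ denotes the spectral radius.
   Context: Setting. $\mathcal G=(\mathcal V,\mathcal E)$ is an undirected connected graph on $\mathcal V=\{1,\dots,N\}$ without self-loops. $W=[w_{ij}]\in\mathbb R^{N\times N}$ is symmetric and doubly stochastic, with $w_{ij}\in(0,1)$ if $(i,j)\in\mathcal E$ or $i=j$, and $w_{ij}=0$ otherwise. Its eigenvalues are $1=\lambda_1>\lambda_2\ge\cdots\ge\lambda_N>-1$, and its essential spectral radius is $\sigma:=\rho(W-\mathbf 1\mathbf 1^\top/N)=\max\{|\lambda_2|,|\lambda_N|\}<1$, where $\rho(\cdot)$ is the spectral radius. Local curvatures $h_i>0$, $i\in\mathcal V$, are given. The average curvature is $\bar h:=\frac1N\sum_i h_i$ and the curvature dispersion is $\eta:=\max_{i}|h_i-\bar h|/\bar h$. Put $D:=\operatorname{diag}(h_1/\bar h,\dots,h_N/\bar h)$ and $\Delta:=D-I$. Let $v:=\mathbf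 1/\sqrt N$ and let $U\in\mathbb R^{N\times(N-1)}$ have as columns orthonormal eigenvectors of $W$ associated with $\lambda_2,\dots,\lambda_N$, so that $[v\ \ U]$ is orthogonal. Put $\Lambda:=\operatorname{diag}(\lambda_2,\dots,\lambda_N)$, $\delta:=U^\top\Delta v\in\mathbb R^{N-1}$, $\widetilde\Delta:=U^\top\Delta U$. For $\beta>0$ the reduced system matrix is the $(2N-1)\times(2N-1)$ matrix $$A(\beta)=\begin{bmatrix}1-\beta & \beta\delta^\top(\Lambda-I) & -\beta\delta^\top\Lambda\\ 0&\Lambda&-\Lambda\\ -\beta\delta&\beta(I+\widetilde\Delta)(\Lambda-I)&(I-\beta(I+\widetilde\Delta))\Lambda\end{bmatrix}.$$ For $\beta\in(0,2)$ and $\sigma\in[0,1)$ define $$R_+(\beta,\sigma):=\tfrac12\Big(\sigma(2-\beta)+\sqrt{\beta\sigma(4(1-\sigma)+\beta\sigma)}\Big),\quad R_-(\beta,\sigma):=\sqrt{\sigma(\sigma+\beta)},$$ $$R_T(\beta,\sigma):=\max\{R_+(\beta,\sigma),R_-(\beta,\sigma)\},\qquad R_0(\beta,\sigma):=\max\{|1-\beta|,R_T(\beta,\sigma)\}.$$ *)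

theory Defs
  imports "Jordan_Normal_Form.Spectral_Radius" "Graph_Theory.Digraph_Component"
begin

text \<open>
  Agents and matrix indices are numbered from \<open>0\<close> to \<open>N - 1\<close>. The sequence \<open>lam\<close> of eigenvalues
  is shifted accordingly: \<open>lam 0\<close> is the leading eigenvalue \<open>1\<close>, and column \<open>j\<close> of \<open>U\<close> belongs to
  \<open>lam (Suc j)\<close>. Undirected simple graphs are symmetric loop-free digraphs (\<^locale>\<open>pair_graph\<close>).
\<close>

definition consensus_graph :: "nat \<Rightarrow> nat pair_pre_digraph \<Rightarrow> bool" where
  "consensus_graph N G \<longleftrightarrow>
     pair_graph G \<and> pverts G = {..<N} \<and> Digraph_Component.connected (with_proj G)"

definition doubly_stochastic :: "nat \<Rightarrow> real mat \<Rightarrow> bool" where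
  "doubly_stochastic N W \<longleftrightarrow> W \<in> carrier_mat N N \<and>
     (\<forall>i<N. \<forall>j<N. 0 \<le> W $$ (i, j)) \<and>
     (\<forall>i<N. (\<Sum>j<N. W $$ (i, j)) = 1) \<and>
     (\<forall>j<N. (\<Sum>i<N. W $$ (i, j)) = 1)"

definition consensus_matrix :: "nat \<Rightarrow> nat pair_pre_digraph \<Rightarrow> real mat \<Rightarrow> bool" where
  "consensus_matrix N G W \<longleftrightarrow>
     doubly_stochastic N W \<and> transpose_mat W = W \<and>
     (\<forall>i<N. \<forall>j<N. if (i, j) \<in> parcs G \<or> i = j
        then 0 < W $$ (i, j) \<and> W $$ (i, j) < 1
        else W $$ (i, j) = 0)"

text \<open>
  Eigenvalues are listed with multiplicity, hence the factorisation of the characteristic polynomial.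
  The bounds on \<open>lam\<close> are automatic for a consensus matrix of a connected graph; they are
  recorded here as part of the standing notation.
\<close>

definition consensus_eigenvalues :: "nat \<Rightarrow> real mat \<Rightarrow> (nat \<Rightarrow> real) \<Rightarrow> bool" where
  "consensus_eigenvalues N W lam \<longleftrightarrow>
     char_poly W = (\<Prod>i<N. [:- lam i, 1:]) \<and>
     lam 0 = 1 \<and>
     (\<forall>i. 0 < i \<and> i < N \<longrightarrow> -1 < lam i \<and> lam i < 1) \<and>
     (\<forall>i j. i \<le> j \<and> j < N \<longrightarrow> lam j \<le> lam i)"

text \<open>
  Orthogonality of \<open>U\<close> to the constant vector need not be required: \<open>W\<close> is symmetric, fixes the
  constant vector, and \<open>lam (Suc j) \<noteq> 1\<close>.
\<close>

definition orthonormal_eigenvectors ::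
    "nat \<Rightarrow> real mat \<Rightarrow> (nat \<Rightarrow> real) \<Rightarrow> real mat \<Rightarrow> bool" where
  "orthonormal_eigenvectors N W lam U \<longleftrightarrow>
     U \<in> carrier_mat N (N - 1) \<and>
     transpose_mat U * U = 1\<^sub>m (N - 1) \<and>
     (\<forall>j < N - 1. eigenvector W (col U j) (lam (Suc j)))"

definition real_spectral_radius :: "real mat \<Rightarrow> real" where
  "real_spectral_radius A = spectral_radius (map_mat complex_of_real A)"

definition ess_spectral_radius :: "nat \<Rightarrow> real mat \<Rightarrow> real" where
  "ess_spectral_radius N W = real_spectral_radius (W - mat N N (\<lambda>_. 1 / real N))"

definition avg_curv :: "nat \<Rightarrow> (nat \<Rightarrow> real) \<Rightarrow> real" where
  "avg_curv N h = (\<Sum>i<N. h i) / real N"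

definition curv_dispersion :: "nat \<Rightarrow> (nat \<Rightarrow> real) \<Rightarrow> real" where
  "curv_dispersion N h = Max ((\<lambda>i. \<bar>h i - avg_curv N h\<bar> / avg_curv N h) ` {..<N})"

definition Delta_mat :: "nat \<Rightarrow> (nat \<Rightarrow> real) \<Rightarrow> real mat" where
  "Delta_mat N h = mat_diag N (\<lambda>i. h i / avg_curv N h) - 1\<^sub>m N"

definition v_col :: "nat \<Rightarrow> real mat" where
  "v_col N = mat N 1 (\<lambda>_. 1 / sqrt (real N))"

definition delta_col :: "nat \<Rightarrow> (nat \<Rightarrow> real) \<Rightarrow> real mat \<Rightarrow> real mat" where
  "delta_col N h U = transpose_mat U * Delta_mat N h * v_col N"

definition Delta_tilde :: "nat \<Rightarrow> (nat \<Rightarrow> real) \<Rightarrow> real mat \<Rightarrow> real mat" where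
  "Delta_tilde N h U = transpose_mat U * Delta_mat N h * U"

definition Lambda_mat :: "nat \<Rightarrow> (nat \<Rightarrow> real) \<Rightarrow> real mat" where
  "Lambda_mat N lam = mat_diag (N - 1) (\<lambda>j. lam (Suc j))"

text \<open>Horizontal concatenation, the counterpart of \<open>@\<^sub>r\<close>.\<close>

definition append_cols :: "'a :: zero mat \<Rightarrow> 'a mat \<Rightarrow> 'a mat" (infixr "@\<^sub>c" 66) where
  "A @\<^sub>c B = four_block_mat A B (0\<^sub>m 0 (dim_col A)) (0\<^sub>m 0 (dim_col B))"

definition reduced_mat ::
    "nat \<Rightarrow> (nat \<Rightarrow> real) \<Rightarrow> (nat \<Rightarrow> real) \<Rightarrow> real mat \<Rightarrow> real \<Rightarrow> real mat" where
  "reduced_mat N h lam U \<beta> =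
    (let \<Lambda> = Lambda_mat N lam; \<delta> = delta_col N h U; \<Delta>' = Delta_tilde N h U; I = 1\<^sub>m (N - 1)
     in ((1 - \<beta>) \<cdot>\<^sub>m 1\<^sub>m 1) @\<^sub>c (\<beta> \<cdot>\<^sub>m (transpose_mat \<delta> * (\<Lambda> - I))) @\<^sub>c (- (\<beta> \<cdot>\<^sub>m (transpose_mat \<delta> * \<Lambda>)))
     @\<^sub>r (0\<^sub>m (N - 1) 1) @\<^sub>c \<Lambda> @\<^sub>c (- \<Lambda>)
     @\<^sub>r (- (\<beta> \<cdot>\<^sub>m \<delta>)) @\<^sub>c (\<beta> \<cdot>\<^sub>m ((I + \<Delta>') * (\<Lambda> - I))) @\<^sub>c ((I - \<beta> \<cdot>\<^sub>m (I + \<Delta>')) * \<Lambda>))"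

lemma reduced_mat_carrier:
  assumes "0 < N" and "U \<in> carrier_mat N (N - 1)"
  shows "reduced_mat N h lam U \<beta> \<in> carrier_mat (2 * N - 1) (2 * N - 1)"
proof -
  have "dim_row (reduced_mat N h lam U \<beta>) = 1 + ((N - 1) + (N - 1))"
    and "dim_col (reduced_mat N h lam U \<beta>) = 1 + ((N - 1) + (N - 1))"
    using carrier_matD[OF assms(2)]
    by (simp_all add: reduced_mat_def Let_def append_rows_def append_cols_def Lambda_mat_def
        delta_col_def Delta_tilde_def v_col_def mat_diag_def)
  then show ?thesis using assms(1) by (intro carrier_matI) simp_all
qed

definition R_plus :: "real \<Rightarrow> real \<Rightarrow> real" where
  "R_plus \<beta> \<sigma> = (\<sigma> * (2 - \<beta>) + sqrt (\<beta> * \<sigma> * (4 * (1 - \<sigma>) + \<beta> * \<sigma>))) / 2"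

definition R_minus :: "real \<Rightarrow> real \<Rightarrow> real" where
  "R_minus \<beta> \<sigma> = sqrt (\<sigma> * (\<sigma> + \<beta>))"

definition R_T :: "real \<Rightarrow> real \<Rightarrow> real" where
  "R_T \<beta> \<sigma> = max (R_plus \<beta> \<sigma>) (R_minus \<beta> \<sigma>)"

definition R_0 :: "real \<Rightarrow> real \<Rightarrow> real" where
  "R_0 \<beta> \<sigma> = max \<bar>1 - \<beta>\<bar> (R_T \<beta> \<sigma>)"

definition Phi :: "real \<Rightarrow> real \<Rightarrow> real \<Rightarrow> real \<Rightarrow> real" where
  "Phi r \<beta> \<sigma> \<eta> =
     \<beta> * (\<eta> + \<beta> * \<eta>\<^sup>2 / (r - \<bar>1 - \<beta>\<bar>)) * (\<sigma> * (1 + r) / (r - R_T \<beta> \<sigma>)\<^sup>2)"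

end

theory Submission
  imports Defs "HOL-Analysis.L2_Norm"
begin

text \<open>Suppose A(\<beta>) has an eigenvector with blocks x, y, z and an eigenvalue m with |m|
  \<ge> r. The second block row says (\<Lambda> - I) y - \<Lambda> z = (m - 1) y, and this is the
  only combination of y and z that enters the first row and that \<beta> (I + U^T \<Delta> U) acts
  on in the third. So x and z can be eliminated, leaving for each mode p_j(m) y_j = - \<beta> (m -
  1) l_j (T y)_j, where p_j(m) = (m - l_j)^2 + \<beta> l_j (m - 1) and T collects the curvature
  heterogeneity. For equal curvatures T = 0, and the spectrum is 1 - \<beta> together with the roots
  of the p_j; R_0 bounds these unperturbed eigenvalues.

  \<open>tracking_quadratic_factor\<close> puts the roots of p_j in the disc of radius R_T, so
  |p_j(m)| \<ge> (|m| - R_T)^2, and \<open>tracking_quadratic_bound\<close> turns this into a bound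
  \<sigma> (1 + r) / (r - R_T)^2 on |m - 1| |l_j| / |p_j(m)|. As |m - 1 + \<beta>| \<ge> r - |1 -
  \<beta>|, \<open>perturbation_bound\<close> bounds the norm of T by \<eta> + \<beta> \<eta>^2 / (r
  - |1 - \<beta>|). Together, |y| \<le> \<Phi> |y| with \<Phi> < 1, so y = 0, and then x and z
  vanish too (\<open>no_large_eigenvalue\<close>): no such eigenvector exists. The remaining lemmas
  read the scalar equations off the block matrix and bound the l_j by \<sigma>.\<close>

section \<open>Roots of the quadratic of a single mode\<close>

text \<open>The quadratic is m^2 - l (2 - \<beta>) m + l^2 - \<beta> l, with discriminant \<beta> l
  (4 (1 - l) + \<beta> l). For l \<ge> 0 the roots are real and the larger one is dominated by its
  value \<open>R_plus\<close> at l = \<sigma>; for l < 0 they are conjugate, and their product l^2 -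
  \<beta> l is the squared modulus, at most \<open>R_minus\<close> squared.\<close>

lemma tracking_quadratic_factor:
  fixes \<beta> \<sigma> l :: real
  assumes \<beta>: "0 < \<beta>" "\<beta> < 2" and \<sigma>: "\<sigma> < 1" and l: "\<bar>l\<bar> \<le> \<sigma>"
  obtains a b :: complex where "cmod a \<le> R_T \<beta> \<sigma>" "cmod b \<le> R_T \<beta> \<sigma>"
    "\<And>m. (m - of_real l)\<^sup>2 + of_real \<beta> * of_real l * (m - 1) = (m - a) * (m - b)"
proof (cases "0 \<le> l")
  case True
  define s S R where "s = sqrt (\<beta> * l * (4 * (1 - l) + \<beta> * l))"
    and "S = sqrt (\<beta> * \<sigma> * (4 * (1 - \<sigma>) + \<beta> * \<sigma>))" and "R = R_plus \<beta> \<sigma>"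
  have l\<sigma>: "l \<le> \<sigma>" "l < 1" "0 \<le> \<sigma>" using l \<sigma> by auto
  have s2: "s\<^sup>2 = \<beta> * l * (4 * (1 - l) + \<beta> * l)" and S2: "S\<^sup>2 = \<beta> * \<sigma> * (4 * (1 - \<sigma>) + \<beta> * \<sigma>)"
    unfolding s_def S_def using \<beta> \<sigma> l\<sigma> True by simp_all
  have s0: "0 \<le> s" "0 \<le> S" unfolding s_def S_def using \<beta> \<sigma> l\<sigma> True by simp_all
  have R2: "2 * R = \<sigma> * (2 - \<beta>) + S" unfolding R_def R_plus_def S_def by simp
  \<comment> \<open>This yields \<sigma> \<le> R, hence R lies to the right of the vertex l (2 -
    \<beta>) / 2 of the parabola.\<close>
  have "(\<beta> * \<sigma>)\<^sup>2 \<le> S\<^sup>2"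
  proof -
    have "S\<^sup>2 - (\<beta> * \<sigma>)\<^sup>2 = 4 * (\<beta> * \<sigma> * (1 - \<sigma>))"
      unfolding S2 by (simp add: power2_eq_square algebra_simps)
    moreover have "0 \<le> \<beta> * \<sigma> * (1 - \<sigma>)" using \<beta> \<sigma> l\<sigma> by simp
    ultimately show ?thesis by linarith
  qed
  then have "\<beta> * \<sigma> \<le> S" using s0(2) by (rule power2_le_imp_le)
  then have R\<sigma>: "\<sigma> \<le> R" using R2 by (simp add: algebra_simps)
  have "(2 * R - \<sigma> * (2 - \<beta>))\<^sup>2 = S\<^sup>2" using R2 by simp
  then have root: "(R - \<sigma>)\<^sup>2 + \<beta> * \<sigma> * (R - 1) = 0"
    unfolding S2 by (simp add: power2_eq_square algebra_simps)
  \<comment> \<open>Being right of the vertex, R exceeds the larger root for l as soon as the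
    quadratic for l is nonnegative there. This stands in for monotonicity of \<open>R_plus\<close>
    in \<sigma>.\<close>
  have q: "0 \<le> (R - l)\<^sup>2 + \<beta> * l * (R - 1)"
  proof (cases "\<sigma> = 0")
    case True
    then have "l = 0" using l by simp
    then show ?thesis by simp
  next
    case False
    \<comment> \<open>As a polynomial in \<open>l\<close> the claim has the roots \<open>\<sigma>\<close> and \<open>R\<^sup>2 / \<sigma>\<close>.\<close>
    have "\<sigma> * ((R - l)\<^sup>2 + \<beta> * l * (R - 1))
        = (\<sigma> - l) * (R\<^sup>2 - \<sigma> * l) + l * ((R - \<sigma>)\<^sup>2 + \<beta> * \<sigma> * (R - 1))"
      by (simp add: power2_eq_square algebra_simps)
    also have "\<dots> = (\<sigma> - l) * (R\<^sup>2 - \<sigma> * l)" using root by simp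
    also have "\<dots> \<ge> 0"
    proof -
      have "\<sigma> * l \<le> R * R" using R\<sigma> l\<sigma> True by (intro mult_mono) auto
      then show ?thesis using l\<sigma> by (simp add: power2_eq_square)
    qed
    finally show ?thesis using False l\<sigma> by (simp add: zero_le_mult_iff)
  qed
  have "s\<^sup>2 \<le> (2 * R - l * (2 - \<beta>))\<^sup>2"
  proof -
    have "(2 * R - l * (2 - \<beta>))\<^sup>2 = s\<^sup>2 + 4 * ((R - l)\<^sup>2 + \<beta> * l * (R - 1))"
      unfolding s2 by (simp add: power2_eq_square algebra_simps)
    then show ?thesis using q by simp
  qed
  moreover have "0 \<le> 2 * R - l * (2 - \<beta>)"
  proof -
    have "l * (2 - \<beta>) \<le> l * 2" using True \<beta> by (intro mult_left_mono) auto
    then show ?thesis using R\<sigma> l\<sigma> by linarith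
  qed
  ultimately have sR: "s \<le> 2 * R - l * (2 - \<beta>)" by (rule power2_le_imp_le)
  have lb: "0 \<le> l * (2 - \<beta>)" using True \<beta> by simp
  have RT: "R \<le> R_T \<beta> \<sigma>" unfolding R_def R_T_def by simp
  define k where "k = l * (2 - \<beta>)"
  note sR = sR[folded k_def] and lb = lb[folded k_def]
  show ?thesis
  proof (rule that[of "of_real ((l * (2 - \<beta>) + s) / 2)" "of_real ((l * (2 - \<beta>) - s) / 2)"])
    show "cmod (of_real ((l * (2 - \<beta>) + s) / 2)) \<le> R_T \<beta> \<sigma>"
      unfolding norm_of_real k_def[symmetric] using sR lb s0 RT by (intro abs_leI) (simp_all add: field_simps)
    show "cmod (of_real ((l * (2 - \<beta>) - s) / 2)) \<le> R_T \<beta> \<sigma>"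
      unfolding norm_of_real k_def[symmetric] using sR lb s0 RT by (intro abs_leI) (simp_all add: field_simps)
    fix m :: complex
    let ?L = "of_real l :: complex" and ?B = "of_real \<beta> :: complex" and ?s = "of_real s :: complex"
    have "?s\<^sup>2 = ?B * ?L * (4 * (1 - ?L) + ?B * ?L)"
      using arg_cong[OF s2, of complex_of_real] by simp
    then have "4 * ((m - ?L)\<^sup>2 + ?B * ?L * (m - 1)) = (2 * m - ?L * (2 - ?B))\<^sup>2 - ?s\<^sup>2"
      by (simp add: power2_eq_square algebra_simps)
    then show "(m - ?L)\<^sup>2 + ?B * ?L * (m - 1)
        = (m - of_real ((l * (2 - \<beta>) + s) / 2)) * (m - of_real ((l * (2 - \<beta>) - s) / 2))"
      by (simp add: power2_eq_square field_simps)
  qed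
next
  case False
  define s where "s = sqrt (- \<beta> * l * (4 * (1 - l) + \<beta> * l))"
  have "0 \<le> 4 * (1 - l) + \<beta> * l"
  proof -
    have "l * 4 \<le> l * \<beta>" using False \<beta> by (intro mult_left_mono_neg) auto
    then show ?thesis by (simp add: algebra_simps)
  qed
  then have s2: "s\<^sup>2 = - \<beta> * l * (4 * (1 - l) + \<beta> * l)"
    unfolding s_def using False \<beta> by (simp add: mult_le_0_iff)
  define a where "a = Complex (l * (2 - \<beta>) / 2) (s / 2)"
  have "(cmod a)\<^sup>2 = l\<^sup>2 + \<beta> * (- l)"
    unfolding a_def cmod_power2 using s2 by (simp add: power2_eq_square field_simps)
  also have "\<dots> \<le> \<sigma>\<^sup>2 + \<beta> * \<sigma>"
    using False l \<beta> by (intro add_mono mult_left_mono) (auto simp: abs_le_square_iff[symmetric])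
  also have "\<dots> = \<sigma> * (\<sigma> + \<beta>)" by (simp add: power2_eq_square algebra_simps)
  finally have "cmod a \<le> R_minus \<beta> \<sigma>" unfolding R_minus_def by (rule real_le_rsqrt)
  then have aR: "cmod a \<le> R_T \<beta> \<sigma>" unfolding R_T_def by simp
  show ?thesis
  proof (rule that[of a "cnj a"])
    fix m :: complex
    have sum: "a + cnj a = of_real (l * (2 - \<beta>))" by (simp add: a_def complex_eq_iff)
    have prod: "a * cnj a = of_real (l\<^sup>2 - \<beta> * l)"
      using \<open>(cmod a)\<^sup>2 = l\<^sup>2 + \<beta> * (- l)\<close> by (simp add: complex_norm_square[symmetric])
    have "(m - a) * (m - cnj a) = m\<^sup>2 - m * (a + cnj a) + a * cnj a"
      by (simp add: power2_eq_square algebra_simps)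
    also have "\<dots> = (m - of_real l)\<^sup>2 + of_real \<beta> * of_real l * (m - 1)"
      unfolding sum prod by (simp add: power2_eq_square algebra_simps)
    finally show "(m - of_real l)\<^sup>2 + of_real \<beta> * of_real l * (m - 1) = (m - a) * (m - cnj a)" ..
  qed (use aR in simp_all)
qed

text \<open>On \<open>r \<le> cmod m\<close> the ratio \<open>cmod (m - 1) / (cmod m - R_T \<beta> \<sigma>)\<^sup>2\<close> is controlled by
  \<open>(1 + t) / (t - R_T \<beta> \<sigma>)\<^sup>2\<close>, which decreases in \<open>t = cmod m\<close>.\<close>

lemma tracking_quadratic_bound:
  fixes \<beta> \<sigma> l r :: real and m :: complex
  assumes \<beta>: "0 < \<beta>" "\<beta> < 2" and \<sigma>: "\<sigma> < 1" and l: "\<bar>l\<bar> \<le> \<sigma>"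
    and r: "R_T \<beta> \<sigma> < r" "r \<le> cmod m"
  defines "p \<equiv> (m - of_real l)\<^sup>2 + of_real \<beta> * of_real l * (m - 1)"
  shows "p \<noteq> 0" and "cmod (m - 1) * \<bar>l\<bar> \<le> \<sigma> * (1 + r) / (r - R_T \<beta> \<sigma>)\<^sup>2 * cmod p"
proof -
  define R t where "R = R_T \<beta> \<sigma>" and "t = cmod m"
  obtain a b where a: "cmod a \<le> R" and b: "cmod b \<le> R" and p: "p = (m - a) * (m - b)"
    using tracking_quadratic_factor[OF \<beta> \<sigma> l] unfolding R_def p_def by metis
  have R0: "0 \<le> R" using a norm_ge_zero[of a] by linarith
  have Rr: "R < r" "r \<le> t" using r by (simp_all add: R_def t_def)
  have "t - R \<le> cmod (m - a)" "t - R \<le> cmod (m - b)"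
    using norm_triangle_ineq2[of m a] norm_triangle_ineq2[of m b] a b unfolding t_def by linarith+
  then have pt: "(t - R)\<^sup>2 \<le> cmod p"
    unfolding p norm_mult power2_eq_square using Rr by (intro mult_mono) auto
  have "0 < (t - R)\<^sup>2" using Rr by simp
  then show "p \<noteq> 0" using pt by auto
  \<comment> \<open>The monotonicity in cross-multiplied form: the difference has the factor t - r,
    and its cofactor is nonnegative because R \<ge> 0.\<close>
  have key: "(1 + t) * (r - R)\<^sup>2 \<le> (1 + r) * (t - R)\<^sup>2"
  proof -
    have "(1 + r) * (t - R)\<^sup>2 - (1 + t) * (r - R)\<^sup>2
        = (t - r) * ((1 + R) * ((r - R) + (t - R)) + (r - R) * (t - R))"
      by (simp add: power2_eq_square algebra_simps)
    moreover have "0 \<le> \<dots>" using Rr R0 by (intro mult_nonneg_nonneg add_nonneg_nonneg) auto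
    ultimately show ?thesis by linarith
  qed
  have "cmod (m - 1) * \<bar>l\<bar> * (r - R)\<^sup>2 \<le> (1 + t) * \<sigma> * (r - R)\<^sup>2"
  proof -
    have "cmod (m - 1) \<le> 1 + t" using norm_triangle_ineq4[of m 1] unfolding t_def by simp
    then show ?thesis using l Rr R0 by (intro mult_right_mono mult_mono) auto
  qed
  also have "\<dots> = \<sigma> * ((1 + t) * (r - R)\<^sup>2)" by simp
  also have "\<dots> \<le> \<sigma> * ((1 + r) * (t - R)\<^sup>2)" using key l by (intro mult_left_mono) auto
  also have "\<dots> \<le> \<sigma> * ((1 + r) * cmod p)" using pt l Rr R0 by (intro mult_left_mono) auto
  finally show "cmod (m - 1) * \<bar>l\<bar> \<le> \<sigma> * (1 + r) / (r - R_T \<beta> \<sigma>)\<^sup>2 * cmod p"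
    using Rr by (simp add: R_def[symmetric] pos_le_divide_eq mult.assoc)
qed

section \<open>Euclidean norm estimates for the perturbation\<close>

lemma norm_sum_mult_le_L2_set:
  fixes f g :: "'b \<Rightarrow> 'a::real_normed_algebra"
  shows "norm (\<Sum>i\<in>A. f i * g i) \<le> L2_set (\<lambda>i. norm (f i)) A * L2_set (\<lambda>i. norm (g i)) A"
proof -
  have "norm (\<Sum>i\<in>A. f i * g i) \<le> (\<Sum>i\<in>A. \<bar>norm (f i)\<bar> * \<bar>norm (g i)\<bar>)"
    by (rule sum_norm_le) (simp add: norm_mult_ineq)
  also have "\<dots> \<le> L2_set (\<lambda>i. norm (f i)) A * L2_set (\<lambda>i. norm (g i)) A"
    by (rule L2_set_mult_ineq)
  finally show ?thesis .
qed

lemma L2_set_cmod_square: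
  "complex_of_real ((L2_set (\<lambda>i. cmod (f i)) A)\<^sup>2) = (\<Sum>i\<in>A. f i * cnj (f i))"
  by (simp add: L2_set_def sum_nonneg flip: complex_norm_square)

lemma L2_set_cmod_mult_le:
  assumes "\<And>i. i \<in> A \<Longrightarrow> cmod (f i) \<le> c" and "0 \<le> c"
  shows "L2_set (\<lambda>i. cmod (f i * g i)) A \<le> c * L2_set (\<lambda>i. cmod (g i)) A"
  using assms by (auto simp: norm_mult L2_set_right_distrib intro!: L2_set_mono mult_right_mono)

text \<open>Columns are real index functions because they act on complex vectors: the eigenvectors
  of the real, nonsymmetric reduced matrix may be complex.\<close>

definition orthonormal_columns :: "nat \<Rightarrow> nat \<Rightarrow> (nat \<Rightarrow> nat \<Rightarrow> real) \<Rightarrow> bool" where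
  "orthonormal_columns N n u \<longleftrightarrow>
     (\<forall>j<n. \<forall>k<n. (\<Sum>i<N. u i j * u i k) = (if j = k then 1 else 0))"

text \<open>Expanding the squared norm of U y produces the Gram matrix of the columns, which is the
  identity.\<close>

lemma orthonormal_columns_isometry:
  fixes y :: "nat \<Rightarrow> complex"
  assumes "orthonormal_columns N n u"
  shows "L2_set (\<lambda>i. cmod (\<Sum>j<n. of_real (u i j) * y j)) {..<N} = L2_set (\<lambda>j. cmod (y j)) {..<n}"
    (is "?l = ?r")
proof -
  have "complex_of_real (?l\<^sup>2)
      = (\<Sum>i<N. (\<Sum>j<n. of_real (u i j) * y j) * cnj (\<Sum>k<n. of_real (u i k) * y k))"
    by (rule L2_set_cmod_square)
  also have "\<dots> = (\<Sum>i<N. \<Sum>j<n. \<Sum>k<n. of_real (u i j * u i k) * (y j * cnj (y k)))"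
    by (simp add: sum_product ac_simps)
  also have "\<dots> = (\<Sum>j<n. \<Sum>k<n. \<Sum>i<N. of_real (u i j * u i k) * (y j * cnj (y k)))"
    by (subst sum.swap, rule sum.cong[OF refl], rule sum.swap)
  also have "\<dots> = (\<Sum>j<n. \<Sum>k<n. of_real (\<Sum>i<N. u i j * u i k) * (y j * cnj (y k)))"
    by (simp add: sum_distrib_right)
  also have "\<dots> = (\<Sum>j<n. \<Sum>k<n. if j = k then y j * cnj (y k) else 0)"
    using assms unfolding orthonormal_columns_def by (intro sum.cong refl) auto
  also have "\<dots> = (\<Sum>j<n. y j * cnj (y j))"
    by (intro sum.cong refl) (simp add: sum.delta')
  also have "\<dots> = complex_of_real (?r\<^sup>2)" by (rule L2_set_cmod_square[symmetric])
  finally have "?l\<^sup>2 = ?r\<^sup>2" by (simp only: of_real_eq_iff)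
  then show ?thesis by (simp add: power2_eq_iff_nonneg)
qed

text \<open>By duality: with q = U^T w, the squared norm of q is the pairing of w with U applied to
  the conjugate of q. Cauchy-Schwarz and the isometry bound it by |w| |q|.\<close>

lemma orthonormal_columns_transpose_contraction:
  fixes w :: "nat \<Rightarrow> complex"
  assumes "orthonormal_columns N n u"
  shows "L2_set (\<lambda>j. cmod (\<Sum>i<N. of_real (u i j) * w i)) {..<n} \<le> L2_set (\<lambda>i. cmod (w i)) {..<N}"
proof -
  define q where "q j = (\<Sum>i<N. of_real (u i j) * w i)" for j
  let ?q = "L2_set (\<lambda>j. cmod (q j)) {..<n}" and ?w = "L2_set (\<lambda>i. cmod (w i)) {..<N}"
  have "complex_of_real (?q\<^sup>2) = (\<Sum>j<n. q j * cnj (q j))" by (rule L2_set_cmod_square)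
  also have "\<dots> = (\<Sum>j<n. \<Sum>i<N. of_real (u i j) * w i * cnj (q j))"
    unfolding q_def[of _] by (simp add: sum_distrib_right)
  also have "\<dots> = (\<Sum>i<N. \<Sum>j<n. of_real (u i j) * w i * cnj (q j))" by (rule sum.swap)
  also have "\<dots> = (\<Sum>i<N. w i * (\<Sum>j<n. of_real (u i j) * cnj (q j)))"
    by (simp add: sum_distrib_left ac_simps)
  finally have "?q\<^sup>2 = cmod (\<Sum>i<N. w i * (\<Sum>j<n. of_real (u i j) * cnj (q j)))"
    by (metis norm_of_real abs_power2)
  also have "\<dots> \<le> ?w * L2_set (\<lambda>i. cmod (\<Sum>j<n. of_real (u i j) * cnj (q j))) {..<N}"
    by (rule norm_sum_mult_le_L2_set)
  also have "\<dots> = ?w * ?q" using orthonormal_columns_isometry[OF assms, of "\<lambda>j. cnj (q j)"] by simp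
  finally have "?q * ?q \<le> ?w * ?q" by (simp add: power2_eq_square)
  then have "?q \<le> ?w"
    by (cases "?q = 0") (simp_all add: L2_set_nonneg mult_le_cancel_right less_le)
  then show ?thesis by (simp add: q_def)
qed

text \<open>With \<open>u = U\<close>, \<open>d = diag \<Delta>\<close> and \<open>v\<close> the averaging vector, the left-hand side below is the norm of
  \<open>(U\<^sup>T \<Delta> U + c \<delta> \<delta>\<^sup>T) y\<close>, which factors as \<open>U\<^sup>T\<close> applied to \<open>\<Delta> U y + c \<Delta> v v\<^sup>T \<Delta> U y\<close>.\<close>

lemma perturbation_bound:
  fixes y :: "nat \<Rightarrow> complex" and c :: complex and d v :: "nat \<Rightarrow> real"
  assumes u: "orthonormal_columns N n u" and d: "\<And>i. i < N \<Longrightarrow> \<bar>d i\<bar> \<le> \<eta>" and \<eta>: "0 \<le> \<eta>"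
    and v: "L2_set v {..<N} \<le> 1"
  defines "\<delta> \<equiv> \<lambda>j. \<Sum>i<N. u i j * d i * v i"
    and "D \<equiv> \<lambda>j k. \<Sum>i<N. u i j * d i * u i k"
  shows "L2_set (\<lambda>j. cmod ((\<Sum>k<n. of_real (D j k) * y k)
            + c * of_real (\<delta> j) * (\<Sum>k<n. of_real (\<delta> k) * y k))) {..<n}
      \<le> (\<eta> + cmod c * \<eta>\<^sup>2) * L2_set (\<lambda>j. cmod (y j)) {..<n}"
proof -
  let ?Y = "L2_set (\<lambda>j. cmod (y j)) {..<n}"
  define a where "a i = (\<Sum>k<n. of_real (u i k) * y k)" for i
  define s where "s = (\<Sum>k<n. of_real (\<delta> k) * y k)"
  define w where "w i = of_real (d i) * a i + of_real (d i) * (c * s * of_real (v i))" for i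
  have aY: "L2_set (\<lambda>i. cmod (a i)) {..<N} = ?Y"
    unfolding a_def by (rule orthonormal_columns_isometry[OF u])
  have dc: "cmod (of_real (d i)) \<le> \<eta>" if "i \<in> {..<N}" for i using d that by simp
  have daY: "L2_set (\<lambda>i. cmod (of_real (d i) * a i)) {..<N} \<le> \<eta> * ?Y"
    using L2_set_cmod_mult_le[where f = "\<lambda>i. of_real (d i)" and g = a and A = "{..<N}", OF dc \<eta>] unfolding aY .
  have Dy: "(\<Sum>k<n. of_real (D j k) * y k) = (\<Sum>i<N. of_real (u i j) * (of_real (d i) * a i))" for j
    unfolding D_def a_def of_real_sum sum_distrib_right sum_distrib_left
    by (subst sum.swap) (simp add: ac_simps)
  \<comment> \<open>Reading \<delta>^T y as v^T (\<Delta> U y) makes \<open>s\<close> cost one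
    factor \<eta>; the \<Delta> in front of v costs the other, whence the \<eta>^2 in the
    bound.\<close>
  have s_eq: "s = (\<Sum>i<N. of_real (v i) * (of_real (d i) * a i))"
    unfolding s_def \<delta>_def a_def of_real_sum sum_distrib_right sum_distrib_left
    by (subst sum.swap) (simp add: ac_simps)
  have "cmod s \<le> L2_set (\<lambda>i. cmod (of_real (v i))) {..<N} * L2_set (\<lambda>i. cmod (of_real (d i) * a i)) {..<N}"
    unfolding s_eq by (rule norm_sum_mult_le_L2_set)
  also have "\<dots> \<le> 1 * (\<eta> * ?Y)"
    using v daY by (intro mult_mono L2_set_nonneg) (simp_all add: L2_set_def)
  finally have s_le: "cmod s \<le> \<eta> * ?Y" by simp
  have "L2_set (\<lambda>i. cmod (c * s * of_real (v i))) {..<N} \<le> cmod (c * s) * L2_set (\<lambda>i. cmod (of_real (v i))) {..<N}"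
    by (rule L2_set_cmod_mult_le) simp_all
  also have "\<dots> \<le> cmod (c * s) * 1"
    using v by (intro mult_left_mono) (simp_all add: L2_set_def)
  also have "\<dots> \<le> cmod c * (\<eta> * ?Y)" using s_le by (simp add: norm_mult mult_left_mono)
  finally have csv: "L2_set (\<lambda>i. cmod (c * s * of_real (v i))) {..<N} \<le> cmod c * (\<eta> * ?Y)" .
  have "(\<Sum>k<n. of_real (D j k) * y k) + c * of_real (\<delta> j) * s = (\<Sum>i<N. of_real (u i j) * w i)" for j
  proof -
    have "c * of_real (\<delta> j) * s = (\<Sum>i<N. of_real (u i j) * (of_real (d i) * (c * s * of_real (v i))))"
      unfolding \<delta>_def by (simp add: sum_distrib_left sum_distrib_right ac_simps)
    then show ?thesis unfolding Dy w_def by (simp add: distrib_left sum.distrib)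
  qed
  then have "L2_set (\<lambda>j. cmod ((\<Sum>k<n. of_real (D j k) * y k) + c * of_real (\<delta> j) * s)) {..<n}
      \<le> L2_set (\<lambda>i. cmod (w i)) {..<N}"
    using orthonormal_columns_transpose_contraction[OF u, of w] by simp
  also have "\<dots> \<le> L2_set (\<lambda>i. cmod (of_real (d i) * a i)
      + cmod (of_real (d i) * (c * s * of_real (v i)))) {..<N}"
    unfolding w_def by (intro L2_set_mono norm_triangle_ineq norm_ge_zero)
  also have "\<dots> \<le> L2_set (\<lambda>i. cmod (of_real (d i) * a i)) {..<N}
      + L2_set (\<lambda>i. cmod (of_real (d i) * (c * s * of_real (v i)))) {..<N}"
    by (rule L2_set_triangle_ineq)
  also have "\<dots> \<le> \<eta> * ?Y + \<eta> * (cmod c * (\<eta> * ?Y))"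
  proof (intro add_mono daY)
    show "L2_set (\<lambda>i. cmod (of_real (d i) * (c * s * of_real (v i)))) {..<N} \<le> \<eta> * (cmod c * (\<eta> * ?Y))"
      using L2_set_cmod_mult_le[where f = "\<lambda>i. of_real (d i)"
            and g = "\<lambda>i. c * s * of_real (v i)" and A = "{..<N}", OF dc \<eta>] mult_left_mono[OF csv \<eta>] by linarith
  qed
  also have "\<dots> = (\<eta> + cmod c * \<eta>\<^sup>2) * ?Y" by (simp add: power2_eq_square algebra_simps)
  finally show ?thesis unfolding s_def .
qed

section \<open>Elimination and contraction\<close>

text \<open>Eliminating \<open>x\<close> and \<open>z\<close> from the eigenvector equations turns them into
  \<open>((m - \<Lambda>)\<^sup>2 + \<beta> (m - 1) \<Lambda>) y = - \<beta> (m - 1) \<Lambda> T y\<close> with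
  \<open>T = U\<^sup>T \<Delta> U - \<beta> / (m - 1 + \<beta>) \<delta> \<delta>\<^sup>T\<close>; for \<open>r \<le> cmod m\<close> this makes \<open>y\<close> a fixed point of a contraction
  with factor \<open>\<Phi>\<close>.\<close>

lemma no_large_eigenvalue:
  fixes x m :: complex and y z :: "nat \<Rightarrow> complex" and l d v :: "nat \<Rightarrow> real" and \<beta> \<sigma> \<eta> r :: real
  assumes \<beta>: "0 < \<beta>" "\<beta> < 2" and \<sigma>: "\<sigma> < 1" and l: "\<And>j. j < n \<Longrightarrow> \<bar>l j\<bar> \<le> \<sigma>"
    and r: "R_0 \<beta> \<sigma> < r" "r \<le> cmod m" and Phi: "Phi r \<beta> \<sigma> \<eta> < 1"
    and u: "orthonormal_columns N n u" and d: "\<And>i. i < N \<Longrightarrow> \<bar>d i\<bar> \<le> \<eta>" and \<eta>: "0 \<le> \<eta>"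
    and v: "L2_set v {..<N} \<le> 1"
  defines "\<delta> \<equiv> \<lambda>j. \<Sum>i<N. u i j * d i * v i"
    and "D \<equiv> \<lambda>j k. \<Sum>i<N. u i j * d i * u i k"
  assumes eq1: "(1 - of_real \<beta>) * x + of_real \<beta> *
      (\<Sum>j<n. of_real (\<delta> j) * ((of_real (l j) - 1) * y j - of_real (l j) * z j)) = m * x"
    and eq2: "\<And>j. j < n \<Longrightarrow> of_real (l j) * y j - of_real (l j) * z j = m * y j"
    and eq3: "\<And>j. j < n \<Longrightarrow> - (of_real \<beta> * of_real (\<delta> j) * x)
      + of_real \<beta> * (((of_real (l j) - 1) * y j - of_real (l j) * z j)
          + (\<Sum>k<n. of_real (D j k) * ((of_real (l k) - 1) * y k - of_real (l k) * z k)))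
      + of_real (l j) * z j = m * z j"
  shows "x = 0" and "\<And>j. j < n \<Longrightarrow> y j = 0 \<and> z j = 0"
proof -
  let ?B = "of_real \<beta> :: complex"
  let ?Y = "L2_set (\<lambda>j. cmod (y j)) {..<n}"
  define g where "g = r - \<bar>1 - \<beta>\<bar>"
  have rT: "R_T \<beta> \<sigma> < r" and g: "0 < g" using r by (simp_all add: R_0_def g_def)
  have m0: "m \<noteq> 0" using g r by (auto simp: g_def)
  have mb: "g \<le> cmod (m - 1 + ?B)"
  proof -
    have "cmod (1 - ?B) = \<bar>1 - \<beta>\<bar>" by (metis of_real_1 of_real_diff norm_of_real)
    then show ?thesis using norm_triangle_ineq2[of m "1 - ?B"] r unfolding g_def by (simp add: algebra_simps)
  qed
  then have mb0: "m - 1 + ?B \<noteq> 0" using g by auto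
  define s where "s = (\<Sum>j<n. of_real (\<delta> j) * y j)"
  \<comment> \<open>The coefficient of \<delta> \<delta>^T left behind when x is eliminated;
    \<open>mb\<close> keeps m away from its pole 1 - \<beta>.\<close>
  define e where "e = - ?B / (m - 1 + ?B)"
  define T where "T j = (\<Sum>k<n. of_real (D j k) * y k) + e * of_real (\<delta> j) * s" for j
  define p where "p j = (m - of_real (l j))\<^sup>2 + ?B * of_real (l j) * (m - 1)" for j
  define K where "K = \<sigma> * (1 + r) / (r - R_T \<beta> \<sigma>)\<^sup>2"
  \<comment> \<open>The second block row simplifies the combination on which the first and third
    rows depend.\<close>
  have w: "(of_real (l j) - 1) * y j - of_real (l j) * z j = (m - 1) * y j" if "j < n" for j
    using eq2[OF that] by (simp add: algebra_simps)
  have xs: "(m - 1 + ?B) * x = ?B * (m - 1) * s"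
  proof -
    have "(\<Sum>j<n. of_real (\<delta> j) * ((of_real (l j) - 1) * y j - of_real (l j) * z j)) = (m - 1) * s"
      unfolding s_def sum_distrib_left by (rule sum.cong) (simp_all add: w)
    from eq1[unfolded this] show ?thesis by (simp add: algebra_simps)
  qed
  have x: "x = - ((m - 1) * e * s)"
  proof -
    have e: "e * (m - 1 + ?B) = - ?B" using mb0 by (simp add: e_def)
    have "(m - 1 + ?B) * (x + (m - 1) * e * s)
        = (m - 1 + ?B) * x + (m - 1) * (e * (m - 1 + ?B)) * s"
      by (simp only: distrib_left ac_simps)
    also have "\<dots> = 0" unfolding xs e by simp
    finally have "x + (m - 1) * e * s = 0" using mb0 by simp
    then show ?thesis by (simp add: eq_neg_iff_add_eq_0)
  qed
  have z: "(m - of_real (l j)) * z j = ?B * (m - 1) * (y j + T j)" if j: "j < n" for j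
  proof -
    have "(\<Sum>k<n. of_real (D j k) * ((of_real (l k) - 1) * y k - of_real (l k) * z k))
        = (m - 1) * (\<Sum>k<n. of_real (D j k) * y k)"
      unfolding sum_distrib_left by (rule sum.cong) (simp_all add: w)
    from eq3[OF j, unfolded w[OF j] this]
    have "(m - of_real (l j)) * z j
        = ?B * ((m - 1) * (y j + (\<Sum>k<n. of_real (D j k) * y k)) - of_real (\<delta> j) * x)"
      by (simp add: algebra_simps)
    also have "(m - 1) * (y j + (\<Sum>k<n. of_real (D j k) * y k)) - of_real (\<delta> j) * x
        = (m - 1) * (y j + T j)"
      unfolding x T_def by (simp add: algebra_simps)
    finally show ?thesis by (simp only: mult.assoc)
  qed
  \<comment> \<open>Multiplying the equation for z by \<open>l j\<close> allows
    \<open>l j * z j\<close> to be replaced through \<open>eq2\<close>, without dividing by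
    \<open>l j\<close>, which may be zero.\<close>
  have py: "p j * y j = - (?B * (m - 1) * of_real (l j) * T j)" if j: "j < n" for j
  proof -
    have "of_real (l j) * z j = (of_real (l j) - m) * y j"
      using eq2[OF j] by (simp add: algebra_simps)
    then have "of_real (l j) * ((m - of_real (l j)) * z j)
        = (m - of_real (l j)) * ((of_real (l j) - m) * y j)"
      by (metis mult.left_commute)
    also have "\<dots> = - ((m - of_real (l j))\<^sup>2 * y j)"
      by (simp add: power2_eq_square algebra_simps)
    finally have "of_real (l j) * ((m - of_real (l j)) * z j) = - ((m - of_real (l j))\<^sup>2 * y j)" .
    from this[unfolded z[OF j]] have "(m - of_real (l j))\<^sup>2 * y j
        = - (of_real (l j) * (?B * (m - 1) * (y j + T j)))" by simp
    then show ?thesis unfolding p_def by (simp add: distrib_right distrib_left ac_simps)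
  qed
  \<comment> \<open>An index is required because \<sigma> \<ge> 0 is inferred from a bound on some
    \<open>l j\<close>; n = 0 is treated apart below.\<close>
  have K0: "0 \<le> K" if "j < n" for j
    using l[OF that] g unfolding K_def g_def by (intro divide_nonneg_nonneg mult_nonneg_nonneg) auto
  have y_le: "cmod (y j) \<le> \<beta> * K * cmod (T j)" if j: "j < n" for j
  proof -
    note b = tracking_quadratic_bound[OF \<beta> \<sigma> l[OF j] rT r(2), folded p_def K_def]
    have "cmod (p j) * cmod (y j) = cmod (p j * y j)" by (simp add: norm_mult)
    also have "\<dots> = \<beta> * (cmod (m - 1) * \<bar>l j\<bar>) * cmod (T j)"
      unfolding py[OF j] using \<beta> by (simp add: norm_mult)
    also have "\<dots> \<le> \<beta> * (K * cmod (p j)) * cmod (T j)"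
      using b(2) \<beta> by (intro mult_right_mono mult_left_mono) auto
    finally have "cmod (p j) * cmod (y j) \<le> cmod (p j) * (\<beta> * K * cmod (T j))"
      by (simp add: ac_simps)
    then show ?thesis using b(1) by simp
  qed
  have "?Y = 0"
  proof (cases "n = 0")
    case False
    then have K0': "0 \<le> K" using K0[of 0] by simp
    have e_le: "cmod e \<le> \<beta> / g"
      using mb g \<beta> unfolding e_def by (simp add: norm_divide frac_le)
    have "?Y \<le> L2_set (\<lambda>j. \<beta> * K * cmod (T j)) {..<n}"
      by (rule L2_set_mono) (simp_all add: y_le)
    also have "\<dots> = \<beta> * K * L2_set (\<lambda>j. cmod (T j)) {..<n}"
      using K0' \<beta> by (simp add: L2_set_right_distrib)
    also have "\<dots> \<le> \<beta> * K * ((\<eta> + cmod e * \<eta>\<^sup>2) * ?Y)"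
      unfolding T_def s_def \<delta>_def D_def
      using K0' \<beta> by (intro mult_left_mono perturbation_bound[OF u d \<eta> v]) auto
    also have "\<dots> \<le> \<beta> * K * ((\<eta> + \<beta> / g * \<eta>\<^sup>2) * ?Y)"
      using e_le K0' \<beta> by (intro mult_left_mono mult_right_mono add_left_mono) auto
    also have "\<dots> = Phi r \<beta> \<sigma> \<eta> * ?Y" unfolding Phi_def K_def g_def by simp
    finally have "(1 - Phi r \<beta> \<sigma> \<eta>) * ?Y \<le> 0" by (simp add: algebra_simps)
    then show ?thesis using Phi L2_set_nonneg[of "\<lambda>j. cmod (y j)" "{..<n}"]
      by (simp add: mult_le_0_iff)
  qed simp
  then have y0: "y j = 0" if "j < n" for j using that by (simp add: L2_set_eq_0_iff)
  then have "s = 0" unfolding s_def by simp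
  then show "x = 0" using xs mb0 by simp
  fix j assume j: "j < n"
  have "T j = 0" unfolding T_def using y0 \<open>s = 0\<close> by simp
  \<comment> \<open>Adding this to \<open>l j * z j = 0\<close> gives \<open>m * z j = 0\<close>, so
    the case m = \<open>l j\<close> needs no separate argument.\<close>
  then have "(m - of_real (l j)) * z j = 0" using z[OF j] y0[OF j] by simp
  moreover have "of_real (l j) * z j = 0" using eq2[OF j] y0[OF j] by simp
  ultimately have "m * z j = 0" by auto
  then show "y j = 0 \<and> z j = 0" using m0 y0[OF j] by simp
qed

section \<open>Entries of the reduced matrix\<close>

text \<open>Follows the block layout 1 + n + n: index 0 carries x, the next n indices y, the last n
  indices z.\<close>

lemma sum_lessThan_Suc_double:
  fixes f :: "nat \<Rightarrow> 'a::comm_monoid_add"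
  shows "(\<Sum>k<Suc (n + n). f k) = f 0 + (\<Sum>j<n. f (Suc j)) + (\<Sum>j<n. f (Suc (n + j)))"
proof -
  have "(\<Sum>k<n + m. g k) = (\<Sum>j<n. g j) + (\<Sum>j<m. g (n + j))" for g :: "nat \<Rightarrow> 'a" and m
    by (induction m) (simp_all add: add.assoc)
  then show ?thesis by (subst sum.lessThan_Suc_shift) (simp add: add.assoc)
qed

lemma Delta_mat_diag: "Delta_mat N h = mat_diag N (\<lambda>i. h i / avg_curv N h - 1)"
  by (rule eq_matI) (auto simp: Delta_mat_def mat_diag_def)

lemma transpose_mult_Delta_mat:
  assumes "U \<in> carrier_mat N n"
  shows "transpose_mat U * Delta_mat N h
    = mat n N (\<lambda>(j, i). U $$ (i, j) * (h i / avg_curv N h - 1))"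
  using assms unfolding Delta_mat_diag
  by (subst mat_diag_mult_right[where nr = n]) (auto intro!: eq_matI)

lemma delta_col_index:
  assumes "U \<in> carrier_mat N n" "j < n"
  shows "delta_col N h U $$ (j, 0)
    = (\<Sum>i<N. U $$ (i, j) * (h i / avg_curv N h - 1) * (1 / sqrt (real N)))"
  using assms unfolding delta_col_def transpose_mult_Delta_mat[OF assms(1)]
  by (simp add: v_col_def scalar_prod_def lessThan_atLeast0)

lemma Delta_tilde_index:
  assumes "U \<in> carrier_mat N n" "j < n" "k < n"
  shows "Delta_tilde N h U $$ (j, k)
    = (\<Sum>i<N. U $$ (i, j) * (h i / avg_curv N h - 1) * U $$ (i, k))"
  using assms unfolding Delta_tilde_def transpose_mult_Delta_mat[OF assms(1)]
  by (simp add: scalar_prod_def lessThan_atLeast0)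

text \<open>Every product with \<Lambda> or \<Lambda> - I has the diagonal factor on the right, so
  it only scales columns and each block entry is explicit.\<close>

lemma reduced_mat_index:
  fixes U :: "real mat" and h lam :: "nat \<Rightarrow> real" and \<beta> :: real
  assumes U: "U \<in> carrier_mat N n" and n: "n = N - 1"
  defines "A \<equiv> reduced_mat N h lam U \<beta>" and "\<delta> \<equiv> \<lambda>j. delta_col N h U $$ (j, 0)"
    and "D \<equiv> \<lambda>i j. Delta_tilde N h U $$ (i, j)" and "l \<equiv> \<lambda>j. lam (Suc j)"
  shows "A $$ (0, 0) = 1 - \<beta>"
    and "j < n \<Longrightarrow> A $$ (0, Suc j) = \<beta> * (\<delta> j * (l j - 1))"
    and "j < n \<Longrightarrow> A $$ (0, Suc (n + j)) = - (\<beta> * (\<delta> j * l j))"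
    and "i < n \<Longrightarrow> A $$ (Suc i, 0) = 0"
    and "i < n \<Longrightarrow> j < n \<Longrightarrow> A $$ (Suc i, Suc j) = (if i = j then l j else 0)"
    and "i < n \<Longrightarrow> j < n \<Longrightarrow> A $$ (Suc i, Suc (n + j)) = (if i = j then - l j else 0)"
    and "i < n \<Longrightarrow> A $$ (Suc (n + i), 0) = - (\<beta> * \<delta> i)"
    and "i < n \<Longrightarrow> j < n \<Longrightarrow>
      A $$ (Suc (n + i), Suc j) = \<beta> * (((if i = j then 1 else 0) + D i j) * (l j - 1))"
    and "i < n \<Longrightarrow> j < n \<Longrightarrow> A $$ (Suc (n + i), Suc (n + j))
      = ((if i = j then 1 else 0) - \<beta> * ((if i = j then 1 else 0) + D i j)) * l j"
proof -
  let ?\<delta> = "delta_col N h U" and ?D = "Delta_tilde N h U"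
  have \<delta>: "?\<delta> \<in> carrier_mat n 1" and D: "?D \<in> carrier_mat n n"
    using U by (auto simp: delta_col_def Delta_tilde_def v_col_def)
  have L: "Lambda_mat N lam = mat_diag n l" by (simp add: Lambda_mat_def n l_def)
  have L1: "mat_diag n l - 1\<^sub>m n = mat_diag n (\<lambda>j. l j - 1)"
    by (rule eq_matI) (auto simp: mat_diag_def)
  have 1: "transpose_mat ?\<delta> * mat_diag n f = mat 1 n (\<lambda>(i, j). \<delta> j * f j)" for f
    using \<delta> by (subst mat_diag_mult_right[where nr = 1]) (auto intro!: eq_matI simp: \<delta>_def)
  have 2: "(1\<^sub>m n + ?D) * mat_diag n f
      = mat n n (\<lambda>(i, j). ((if i = j then 1 else 0) + D i j) * f j)" for f
    using D by (subst mat_diag_mult_right[where nr = n]) (auto intro!: eq_matI simp: D_def)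
  have 3: "(1\<^sub>m n - \<beta> \<cdot>\<^sub>m (1\<^sub>m n + ?D)) * mat_diag n f
      = mat n n (\<lambda>(i, j). ((if i = j then 1 else 0) - \<beta> * ((if i = j then 1 else 0) + D i j)) * f j)" for f
    using D by (subst mat_diag_mult_right[where nr = n]) (auto intro!: eq_matI simp: D_def)
  note A = A_def reduced_mat_def Let_def n[symmetric] L L1 1 2 3
    append_rows_def append_cols_def
  have dims: "dim_row ?\<delta> = n" "dim_col ?\<delta> = 1" using \<delta> by auto
  show "A $$ (0, 0) = 1 - \<beta>"
    and "j < n \<Longrightarrow> A $$ (0, Suc j) = \<beta> * (\<delta> j * (l j - 1))"
    and "j < n \<Longrightarrow> A $$ (0, Suc (n + j)) = - (\<beta> * (\<delta> j * l j))"
    and "i < n \<Longrightarrow> A $$ (Suc i, 0) = 0"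
    and "i < n \<Longrightarrow> j < n \<Longrightarrow> A $$ (Suc i, Suc j) = (if i = j then l j else 0)"
    and "i < n \<Longrightarrow> j < n \<Longrightarrow> A $$ (Suc i, Suc (n + j)) = (if i = j then - l j else 0)"
    and "i < n \<Longrightarrow> A $$ (Suc (n + i), 0) = - (\<beta> * \<delta> i)"
    and "i < n \<Longrightarrow> j < n \<Longrightarrow>
      A $$ (Suc (n + i), Suc j) = \<beta> * (((if i = j then 1 else 0) + D i j) * (l j - 1))"
    and "i < n \<Longrightarrow> j < n \<Longrightarrow> A $$ (Suc (n + i), Suc (n + j))
      = ((if i = j then 1 else 0) - \<beta> * ((if i = j then 1 else 0) + D i j)) * l j"
    unfolding A by (simp_all add: dims mat_diag_def \<delta>_def D_def)
qed

section \<open>Eigenvectors and spectral radii\<close>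

lemma eigenvectorD_sum:
  assumes "A \<in> carrier_mat N N" and "eigenvector A w k" and "i < N"
  shows "(\<Sum>j<N. A $$ (i, j) * w $ j) = k * w $ i"
proof -
  have w: "w \<in> carrier_vec N" "A *\<^sub>v w = k \<cdot>\<^sub>v w" using assms(1,2) by (auto simp: eigenvector_def)
  have "(\<Sum>j<N. A $$ (i, j) * w $ j) = (A *\<^sub>v w) $ i"
    using assms(1,3) w(1) by (simp add: scalar_prod_def lessThan_atLeast0)
  then show ?thesis using w assms(3) by simp
qed

text \<open>Since \<open>W\<close> has unit column sums, an eigenvector for an eigenvalue other than \<open>1\<close> sums to zero,
  so that subtracting the averaging matrix leaves it an eigenvector.\<close>

lemma eigenvalue_le_ess_spectral_radius:
  assumes W: "doubly_stochastic N W" and w: "eigenvector W w k" and k: "k \<noteq> 1" and N: "0 < N"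
  shows "\<bar>k\<bar> \<le> ess_spectral_radius N W"
proof -
  let ?M = "W - mat N N (\<lambda>_. 1 / real N)" and ?c = "map_vec complex_of_real w"
  have WN: "W \<in> carrier_mat N N" and col: "\<And>j. j < N \<Longrightarrow> (\<Sum>i<N. W $$ (i, j)) = 1"
    using W by (auto simp: doubly_stochastic_def)
  have wN: "w \<in> carrier_vec N" "w \<noteq> 0\<^sub>v N" using w WN by (auto simp: eigenvector_def)
  note ev = eigenvectorD_sum[OF WN w]
  have "k * (\<Sum>i<N. w $ i) = (\<Sum>i<N. \<Sum>j<N. W $$ (i, j) * w $ j)"
    by (simp add: sum_distrib_left ev)
  also have "\<dots> = (\<Sum>j<N. (\<Sum>i<N. W $$ (i, j)) * w $ j)"
    by (subst sum.swap) (simp add: sum_distrib_right)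
  also have "\<dots> = (\<Sum>i<N. w $ i)" by (simp add: col)
  finally have sum0: "(\<Sum>i<N. w $ i) = 0" using k by simp
  have MN: "?M \<in> carrier_mat N N" using WN by auto
  have "?M *\<^sub>v w = k \<cdot>\<^sub>v w"
  proof (rule eq_vecI)
    fix i assume "i < dim_vec (k \<cdot>\<^sub>v w)"
    then have i: "i < N" using wN by simp
    have "(?M *\<^sub>v w) $ i = (\<Sum>j<N. (W $$ (i, j) - 1 / real N) * w $ j)"
      using i WN wN by (simp add: scalar_prod_def lessThan_atLeast0)
    also have "\<dots> = (\<Sum>j<N. W $$ (i, j) * w $ j) - 1 / real N * (\<Sum>j<N. w $ j)"
      by (simp add: left_diff_distrib sum_subtractf sum_distrib_left)
    finally show "(?M *\<^sub>v w) $ i = (k \<cdot>\<^sub>v w) $ i" using ev[OF i] sum0 i wN by simp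
  qed (use WN wN in simp)
  then have "eigenvector ?M w k" using MN wN by (simp add: eigenvector_def)
  then have "eigenvalue (map_mat complex_of_real ?M) (of_real k)"
    using of_real_hom.eigenvalue_hom[OF MN] unfolding eigenvalue_def by blast
  then have "of_real k \<in> spectrum (map_mat complex_of_real ?M)" by (simp add: spectrum_def)
  from imageI[OF this, of norm] show ?thesis
    using spectral_radius_mem_max(2)[of "map_mat complex_of_real ?M" N] MN N
    by (auto simp: ess_spectral_radius_def real_spectral_radius_def)
qed

text \<open>In positive dimension the spectral radius is attained at an eigenvalue, so a strict
  bound on each eigenvalue survives the maximum.\<close>

lemma real_spectral_radius_less:
  assumes A: "A \<in> carrier_mat n n" and n: "0 < n"
    and small: "\<And>w m. eigenvector (map_mat complex_of_real A) w m \<Longrightarrow> cmod m < r"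
  shows "real_spectral_radius A < r"
proof -
  have "spectral_radius (map_mat complex_of_real A) \<in> norm ` spectrum (map_mat complex_of_real A)"
    using A n by (intro spectral_radius_mem_max(1)[of _ n]) auto
  then show ?thesis
    using small by (auto simp: real_spectral_radius_def spectrum_def eigenvalue_def)
qed

section \<open>From block eigenvectors to scalar equations\<close>

theorem lemma3:
  fixes N :: nat and G :: "nat pair_pre_digraph" and W U :: "real mat"
    and lam h :: "nat \<Rightarrow> real" and \<beta> r \<sigma> \<eta> :: real
  assumes "consensus_graph N G"
    and "consensus_matrix N G W"
    and "consensus_eigenvalues N W lam"
    and "orthonormal_eigenvectors N W lam U"
    and "\<And>i. i < N \<Longrightarrow> 0 < h i"
    and "\<sigma> = ess_spectral_radius N W" and "0 < \<sigma>" and "\<sigma> < 1"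
    and "\<eta> = curv_dispersion N h" and "0 < \<eta>"
    and "0 < \<beta>" and "\<beta> < 2"
    and "R_0 \<beta> \<sigma> < r" and "r < 1"
    and "Phi r \<beta> \<sigma> \<eta> < 1"
  shows "real_spectral_radius (reduced_mat N h lam U \<beta>) < r"
proof -
  define n where "n = N - 1"
  define A where "A = reduced_mat N h lam U \<beta>"
  define d where "d i = h i / avg_curv N h - 1" for i
  define l where "l j = lam (Suc j)" for j
  define u where "u i j = U $$ (i, j)" for i j
  define v :: "nat \<Rightarrow> real" where "v i = 1 / sqrt (real N)" for i
  have "pverts G \<noteq> {}" "pverts G = {..<N}"
    using assms(1) by (auto simp: consensus_graph_def connected_def strongly_connected_def)
  then have N: "0 < N" by auto
  have Nn: "2 * N - 1 = Suc (n + n)" using N by (simp add: n_def)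
  have U: "U \<in> carrier_mat N n" and UU: "transpose_mat U * U = 1\<^sub>m n"
    and Uev: "\<And>j. j < n \<Longrightarrow> eigenvector W (col U j) (l j)"
    using assms(4) by (auto simp: orthonormal_eigenvectors_def n_def l_def)
  have A: "A \<in> carrier_mat (Suc (n + n)) (Suc (n + n))"
    unfolding A_def Nn[symmetric] using reduced_mat_carrier[OF N] U by (simp add: n_def)
  have orth: "orthonormal_columns N n u"
    unfolding orthonormal_columns_def
  proof (intro allI impI)
    fix j k assume jk: "j < n" "k < n"
    then have "(\<Sum>i<N. u i j * u i k) = (transpose_mat U * U) $$ (j, k)"
      using U by (simp add: u_def scalar_prod_def lessThan_atLeast0)
    then show "(\<Sum>i<N. u i j * u i k) = (if j = k then 1 else 0)" using jk by (simp add: UU)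
  qed
  have avg: "0 < avg_curv N h"
    unfolding avg_curv_def using N assms(5) by (intro divide_pos_pos sum_pos) auto
  have d: "\<bar>d i\<bar> \<le> \<eta>" if i: "i < N" for i
  proof -
    have "\<bar>d i\<bar> = \<bar>h i - avg_curv N h\<bar> / avg_curv N h"
      using avg by (simp add: d_def diff_divide_distrib[symmetric] abs_divide field_simps)
    also have "\<dots> \<le> \<eta>" unfolding assms(9) curv_dispersion_def using i by (intro Max_ge) auto
    finally show ?thesis .
  qed
  have v: "L2_set v {..<N} \<le> 1"
    using N by (simp add: L2_set_def v_def power_divide)
  have l: "\<bar>l j\<bar> \<le> \<sigma>" if j: "j < n" for j
  proof -
    have "0 < Suc j \<and> Suc j < N" using j by (simp add: n_def)
    then have "l j < 1" using assms(3) unfolding consensus_eigenvalues_def l_def by blast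
    then have "l j \<noteq> 1" by simp
    then show ?thesis unfolding assms(6)
      using assms(2) Uev[OF j] N
      by (intro eigenvalue_le_ess_spectral_radius) (auto simp: consensus_matrix_def)
  qed
  define \<delta> where "\<delta> j = (\<Sum>i<N. u i j * d i * v i)" for j
  define D where "D j k = (\<Sum>i<N. u i j * d i * u i k)" for j k
  note ix = reduced_mat_index[OF U n_def, where h = h and lam = lam and \<beta> = \<beta>, folded A_def l_def]
  have \<delta>: "delta_col N h U $$ (j, 0) = \<delta> j" if "j < n" for j
    using delta_col_index[OF U that] by (simp add: \<delta>_def u_def d_def v_def)
  have D: "Delta_tilde N h U $$ (j, k) = D j k" if "j < n" "k < n" for j k
    using Delta_tilde_index[OF U that] by (simp add: D_def u_def d_def)
  show ?thesis unfolding A_def[symmetric]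
  proof (rule real_spectral_radius_less[OF A])
    fix w m assume ev: "eigenvector (map_mat complex_of_real A) w m"
    show "cmod m < r"
    proof (rule ccontr)
      assume "\<not> cmod m < r"
      then have rm: "r \<le> cmod m" by simp
      define y where "y j = w $ Suc j" for j
      define z where "z j = w $ Suc (n + j)" for j
      have w: "w \<in> carrier_vec (Suc (n + n))" "w \<noteq> 0\<^sub>v (Suc (n + n))"
        using ev A by (auto simp: eigenvector_def)
      \<comment> \<open>Row i of the eigenvector equation, split along the three blocks;
        \<open>eq1\<close>, \<open>eq2\<close> and \<open>eq3\<close> are its instances in the three
        row blocks.\<close>
      have row: "of_real (A $$ (i, 0)) * w $ 0 + (\<Sum>j<n. of_real (A $$ (i, Suc j)) * y j)
          + (\<Sum>j<n. of_real (A $$ (i, Suc (n + j))) * z j) = m * w $ i" if i: "i < Suc (n + n)" for i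
      proof -
        have "(\<Sum>k<Suc (n + n). of_real (A $$ (i, k)) * w $ k)
            = (\<Sum>k<Suc (n + n). map_mat complex_of_real A $$ (i, k) * w $ k)"
          using A i by (intro sum.cong) auto
        also have "\<dots> = m * w $ i" using A i by (intro eigenvectorD_sum[OF _ ev]) auto
        finally show ?thesis unfolding sum_lessThan_Suc_double y_def z_def .
      qed
      have eq1: "(1 - of_real \<beta>) * w $ 0 + of_real \<beta> * (\<Sum>j<n. of_real (\<delta> j)
          * ((of_real (l j) - 1) * y j - of_real (l j) * z j)) = m * w $ 0"
      proof -
        have "of_real \<beta> * (\<Sum>j<n. of_real (\<delta> j) * ((of_real (l j) - 1) * y j - of_real (l j) * z j))
            = (\<Sum>j<n. of_real (A $$ (0, Suc j)) * y j) + (\<Sum>j<n. of_real (A $$ (0, Suc (n + j))) * z j)"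
          unfolding sum_distrib_left sum.distrib[symmetric]
          by (intro sum.cong refl, simp add: ix \<delta>) (simp add: algebra_simps)
        then show ?thesis using row[of 0] by (simp add: ix(1) add.assoc)
      qed
      have eq2: "of_real (l i) * y i - of_real (l i) * z i = m * y i" if i: "i < n" for i
      proof -
        have "(\<Sum>j<n. of_real (A $$ (Suc i, Suc j)) * y j) = (\<Sum>j<n. if j = i then of_real (l i) * y i else 0)"
          by (intro sum.cong refl) (auto simp: ix i)
        moreover have "(\<Sum>j<n. of_real (A $$ (Suc i, Suc (n + j))) * z j)
            = (\<Sum>j<n. if j = i then - (of_real (l i) * z i) else 0)"
          by (intro sum.cong refl) (auto simp: ix i)
        ultimately show ?thesis using row[of "Suc i"] i by (simp add: ix(4) y_def[symmetric])
      qed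
      have eq3: "- (of_real \<beta> * of_real (\<delta> i) * w $ 0)
          + of_real \<beta> * (((of_real (l i) - 1) * y i - of_real (l i) * z i)
            + (\<Sum>k<n. of_real (D i k) * ((of_real (l k) - 1) * y k - of_real (l k) * z k)))
          + of_real (l i) * z i = m * z i" if i: "i < n" for i
      proof -
        \<comment> \<open>Entries of the third block row split into an identity part, whose sum
          collapses to \<open>?s\<close>, and a part from U^T \<Delta> U, summed by
          \<open>?t\<close>.\<close>
        let ?t = "\<lambda>k. of_real \<beta> * of_real (D i k) * ((of_real (l k) - 1) * y k - of_real (l k) * z k)"
        let ?s = "of_real \<beta> * ((of_real (l i) - 1) * y i - of_real (l i) * z i) + of_real (l i) * z i"
        have "(\<Sum>j<n. of_real (A $$ (Suc (n + i), Suc j)) * y j)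
            + (\<Sum>j<n. of_real (A $$ (Suc (n + i), Suc (n + j))) * z j)
            = (\<Sum>j<n. (if j = i then ?s else 0) + ?t j)"
          unfolding sum.distrib[symmetric]
          by (intro sum.cong refl, simp add: ix D i) (simp add: algebra_simps)
        also have "\<dots> = ?s + (\<Sum>j<n. ?t j)" using i by (simp add: sum.distrib)
        also have "(\<Sum>j<n. ?t j) = of_real \<beta>
            * (\<Sum>k<n. of_real (D i k) * ((of_real (l k) - 1) * y k - of_real (l k) * z k))"
          by (simp only: sum_distrib_left mult.assoc)
        finally show ?thesis
          using row[of "Suc (n + i)", unfolded add.assoc] i
          by (simp add: ix(7) \<delta> z_def[symmetric]) (simp add: distrib_left add_ac add_diff_eq)
      qed
      note zero = no_large_eigenvalue[where l = l and d = d and u = u and v = v and n = n and N = N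
          and x = "w $ 0" and y = y and z = z, folded \<delta>_def D_def,
          OF assms(11,12,8) l assms(13) rm assms(15) orth d less_imp_le[OF assms(10)] v eq1 eq2 eq3]
      have "w = 0\<^sub>v (Suc (n + n))"
      proof (rule eq_vecI)
        fix k assume "k < dim_vec (0\<^sub>v (Suc (n + n)) :: complex vec)"
        then consider "k = 0" | j where "j < n" "k = Suc j" | j where "j < n" "k = Suc (n + j)"
          by (cases k) (auto, metis add_diff_inverse_nat nat_add_left_cancel_less)
        then show "w $ k = 0\<^sub>v (Suc (n + n)) $ k"
          using zero by cases (auto simp: y_def z_def)
      qed (use w in simp)
      then show False using w by simp
    qed
  qed simp
qed

end
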